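(* For all positive integers $n$ and $q$, $$(q-1)!\,b_q(n)=\#\{\pi\in S_{n+q-1}\mid Del_q(\pi)-1=Des_q(\pi)\}=\#Avoid_q(n+q-1).$$
   Context: $b_q(n)=\sum_k q^kS(n,k)$ is the $n$-th $q$-Bell number, where $S(n,k)$ is the Stirling number of the second kind. Let $m=n+q-1$ and $\pi\in S_m$. $Del_q(\pi)=\{ i \mid q+1\le i\le m,\ \#\{j<i\mid \pi(j)<\pi(i)\}\le q-1\}$, and $Del_q(\pi)-1=\{i-1\mid i\in Del_q(\pi)\}$. The $q$-descent set $Des_q(\pi)$ is the set of $i$ with $q\le i\le m-1$ such that $\pi(i)>\pi(i+1)$ or $i+1\in Del_q(\pi)$ (or both). $Pat(q)=\{(\sigma_1-\sigma_2-\cdots-\sigma_q-(q+2)(q+1))\mid \sigma\in S_q\}$ is a set of $q!$ dashed patterns. A permutation $\pi\in S_m$ contains the pattern $(\sigma_1-\cdots-\sigma_q-(q+2)(q+1))$ if there are positions $1\le i_1<\cdots<i_q<i_{q+1}<m$ such that $\pi(i_1),\dots,\pi(i_q),\pi(i_{q+1}),\pi(i_{q+1}+1)$ is order-isomorphic to $\sigma_1,\dots,\sigma_q,q+2,q+1$; otherwise it avoids the pattern. $Avoid_q(m)$ is the set of permutations in $S_m$ avoiding all patterns in $Pat(q)$. *)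

theory Defs
  imports "HOL-Combinatorics.Permutations" "HOL-Combinatorics.Stirling"
begin

definition q_bell :: "nat \<Rightarrow> nat \<Rightarrow> nat" where
  "q_bell q n = (\<Sum>k\<le>n. q ^ k * Stirling n k)"

text \<open>Permutations in \<open>S\<^sub>m\<close> are functions \<open>\<pi>\<close> with \<open>\<pi> permutes {1..m}\<close>; positions are
  counted from 1.\<close>

definition Del :: "nat \<Rightarrow> nat \<Rightarrow> (nat \<Rightarrow> nat) \<Rightarrow> nat set" where
  "Del q m \<pi> = {i. q + 1 \<le> i \<and> i \<le> m \<and> card {j. 1 \<le> j \<and> j < i \<and> \<pi> j < \<pi> i} \<le> q - 1}"

definition Des :: "nat \<Rightarrow> nat \<Rightarrow> (nat \<Rightarrow> nat) \<Rightarrow> nat set" where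
  "Des q m \<pi> = {i. q \<le> i \<and> i \<le> m - 1 \<and> (\<pi> i > \<pi> (i + 1) \<or> i + 1 \<in> Del q m \<pi>)}"

definition order_isomorphic :: "nat list \<Rightarrow> nat list \<Rightarrow> bool" where
  "order_isomorphic xs ys \<longleftrightarrow> length xs = length ys \<and>
     (\<forall>a<length xs. \<forall>b<length xs. xs ! a < xs ! b \<longleftrightarrow> ys ! a < ys ! b)"

text \<open>A list \<open>[p\<^sub>1, \<dots>, p\<^sub>r, p\<^sub>r\<^sub>+\<^sub>1]\<close> stands for the dashed pattern
  \<open>p\<^sub>1-p\<^sub>2-\<dots>-p\<^sub>r p\<^sub>r\<^sub>+\<^sub>1\<close>, in which exactly the last two letters are not separated by a dash.\<close>

definition Pat :: "nat \<Rightarrow> nat list set" where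
  "Pat q = {map \<sigma> [1..<q + 1] @ [q + 2, q + 1] | \<sigma>. \<sigma> permutes {1..q}}"

definition contains_pattern :: "nat \<Rightarrow> (nat \<Rightarrow> nat) \<Rightarrow> nat list \<Rightarrow> bool" where
  "contains_pattern m \<pi> p \<longleftrightarrow>
     (\<exists>i :: nat \<Rightarrow> nat. let r = length p - 1 in
        strict_mono_on {1..r} i \<and> (\<forall>t\<in>{1..r}. 1 \<le> i t \<and> i t < m) \<and>
        order_isomorphic (map (\<lambda>t. \<pi> (i t)) [1..<r + 1] @ [\<pi> (i r + 1)]) p)"

definition Avoid :: "nat \<Rightarrow> nat \<Rightarrow> (nat \<Rightarrow> nat) set" where
  "Avoid q m = {\<pi>. \<pi> permutes {1..m} \<and> (\<forall>p\<in>Pat q. \<not> contains_pattern m \<pi> p)}"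

end

theory Submission
  imports Defs
begin

text \<open>
  Call \<open>#{j < i. \<pi> j < \<pi> i}\<close> the left rank of position \<open>i\<close>. The inclusion of \<open>Del\<^sub>q(\<pi>) - 1\<close> in
  \<open>Des\<^sub>q(\<pi>)\<close> always holds, so the two sets agree exactly if every descent bottom \<open>i + 1\<close> with
  \<open>i \<ge> q\<close> has left rank less than \<open>q\<close>. On the other hand, an occurrence of a pattern from \<open>Pat(q)\<close>
  is a descent together with \<open>q\<close> earlier letters below its bottom, in any relative order, and
  so avoiding \<open>Pat(q)\<close> is the same condition (a descent at \<open>i < q\<close> never has \<open>q\<close> earlier letters).
  The two sets of permutations in the theorem are therefore equal, and both are \<open>tame q m\<close> below.

  For the enumeration, \<open>\<pi> \<in> S\<^sub>m\<^sub>+\<^sub>1\<close> is encoded by its last letter \<open>v\<close> and the standardisation \<open>\<pi>'\<close> of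
  the other letters. Left ranks of earlier positions do not change, and that of the last position
  is \<open>v - 1\<close>; hence \<open>\<pi>\<close> is tame iff \<open>\<pi>'\<close> is and \<open>v \<le> q\<close> or \<open>\<pi>'(m) < v\<close>
  (\<open>card_tame_last_eq\<close>). Let \<open>a m t\<close> count the tame permutations of size \<open>m\<close> with last letter
  at most \<open>t\<close>. Then \<open>a (m + 1) t = t * a m m\<close> for \<open>t \<le> min q (m + 1)\<close>, and for \<open>q \<le> t \<le> m\<close> the
  array grows like the Bell triangle, \<open>a (m + 1) (t + 1) = a (m + 1) t + a m t\<close>. As for the Bell triangle, unrolling
  this yields \<open>T (n + 1) = q * (\<Sum>j\<le>n. (n choose j) * T j)\<close> for the numbers of tame permutations
  of size \<open>n + q - 1\<close> (\<open>bell_triangle_recurrence\<close>). The \<open>q\<close>-Bell numbers satisfy the same linear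
  recurrence (\<open>q_bell_Suc\<close>). Since \<open>T 0 = (q - 1)!\<close> and \<open>b\<^sub>q(0) = 1\<close>, the factor is \<open>(q - 1)!\<close>.
\<close>

section \<open>The binomial recurrence of the \<open>q\<close>-Bell numbers\<close>

lemma sum_binomial_Suc:
  fixes f :: "nat \<Rightarrow> nat"
  shows "(\<Sum>j\<le>Suc n. (Suc n choose j) * f j) = (\<Sum>j\<le>n. (n choose j) * (f j + f (Suc j)))"
proof -
  have "(\<Sum>j\<le>Suc n. (Suc n choose j) * f j) = f 0 + (\<Sum>j\<le>n. (Suc n choose Suc j) * f (Suc j))"
    by (subst sum.atMost_Suc_shift) simp
  also have "\<dots> = (f 0 + (\<Sum>j\<le>n. (n choose Suc j) * f (Suc j)))
                   + (\<Sum>j\<le>n. (n choose j) * f (Suc j))"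
    by (simp add: algebra_simps sum.distrib)
  also have "f 0 + (\<Sum>j\<le>n. (n choose Suc j) * f (Suc j)) = (\<Sum>j\<le>Suc n. (n choose j) * f j)"
    by (subst sum.atMost_Suc_shift) simp
  also have "\<dots> = (\<Sum>j\<le>n. (n choose j) * f j)"
    by simp
  finally show ?thesis
    by (simp add: algebra_simps sum.distrib)
qed

text \<open>Choosing the \<open>j\<close> elements outside the block of a fixed element explains the formula. The
  induction rests on \<open>Stirling (j + 1) k + Stirling j k = (k + 1) * Stirling j k + Stirling j (k - 1)\<close>
  for \<open>k \<ge> 1\<close>.\<close>

lemma Stirling_Suc_Suc_binomial:
  "Stirling (Suc n) (Suc k) = (\<Sum>j\<le>n. (n choose j) * Stirling j k)"
proof (induction n arbitrary: k)
  case 0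
  show ?case by (cases k) auto
next
  case (Suc n)
  have "(\<Sum>j\<le>n. (n choose j) * (Stirling j k + Stirling (Suc j) k))
          = Stirling (Suc (Suc n)) (Suc k)"
  proof (cases k)
    case 0
    have "(\<Sum>j\<le>n. (n choose j) * (Stirling j 0 + Stirling (Suc j) 0)) = Stirling (Suc n) (Suc 0)"
      unfolding Suc.IH by simp
    then show ?thesis unfolding 0 by (simp only: Stirling_1)
  next
    case (Suc l)
    have "(\<Sum>j\<le>n. (n choose j) * (Stirling j k + Stirling (Suc j) k))
        = Suc k * (\<Sum>j\<le>n. (n choose j) * Stirling j k) + (\<Sum>j\<le>n. (n choose j) * Stirling j l)"
      unfolding Suc by (simp add: algebra_simps sum.distrib sum_distrib_left)
    also have "\<dots> = Suc k * Stirling (Suc n) (Suc k) + Stirling (Suc n) (Suc l)"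
      by (simp only: Suc.IH)
    finally show ?thesis unfolding Suc by simp
  qed
  then show ?case by (simp only: sum_binomial_Suc)
qed

lemma q_bell_Suc: "q_bell q (Suc n) = q * (\<Sum>j\<le>n. (n choose j) * q_bell q j)"
proof -
  have "q_bell q (Suc n) = (\<Sum>k\<le>n. q ^ Suc k * Stirling (Suc n) (Suc k))"
    unfolding q_bell_def by (subst sum.atMost_Suc_shift) simp
  also have "\<dots> = (\<Sum>k\<le>n. \<Sum>j\<le>n. q * ((n choose j) * (q ^ k * Stirling j k)))"
    unfolding Stirling_Suc_Suc_binomial by (simp add: sum_distrib_left algebra_simps)
  also have "\<dots> = (\<Sum>j\<le>n. \<Sum>k\<le>n. q * ((n choose j) * (q ^ k * Stirling j k)))"
    by (rule sum.swap)
  also have "\<dots> = q * (\<Sum>j\<le>n. (n choose j) * (\<Sum>k\<le>n. q ^ k * Stirling j k))"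
    by (simp add: sum_distrib_left)
  also have "(\<Sum>j\<le>n. (n choose j) * (\<Sum>k\<le>n. q ^ k * Stirling j k))
           = (\<Sum>j\<le>n. (n choose j) * q_bell q j)"
  proof (intro sum.cong arg_cong2[of _ _ _ _ times] refl)
    fix j assume "j \<in> {..n}"
    then show "(\<Sum>k\<le>n. q ^ k * Stirling j k) = q_bell q j"
      unfolding q_bell_def by (intro sum.mono_neutral_right) auto
  qed
  finally show ?thesis .
qed

section \<open>The Bell triangle\<close>

text \<open>Each step to the right in the array applies one Pascal step, so the entry in column \<open>e\<close> is a
  binomial combination of the column-zero entries of \<open>e + 1\<close> consecutive rows.\<close>

lemma bell_triangle_recurrence:
  fixes A :: "nat \<Rightarrow> nat \<Rightarrow> nat" and T :: "nat \<Rightarrow> nat"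
  assumes first: "\<And>n. A (Suc n) 0 = q * T n"
    and step: "\<And>n e. e < n \<Longrightarrow> A (Suc n) (Suc e) = A (Suc n) e + A n e"
    and diagonal: "\<And>n. A (Suc n) n = T (Suc n)"
  shows "T (Suc n) = q * (\<Sum>j\<le>n. (n choose j) * T j)"
proof -
  have row: "A (Suc n) e = q * (\<Sum>j\<le>e. (e choose j) * T (n - j))" if "e \<le> n" for n e
    using that
  proof (induction e arbitrary: n)
    case 0
    then show ?case by (simp add: first)
  next
    case (Suc e)
    then obtain l where l: "n = Suc l" by (cases n) auto
    have "A (Suc n) (Suc e) = A (Suc n) e + A (Suc l) e"
      using step[of e n] Suc.prems l by simp
    also have "\<dots> = q * (\<Sum>j\<le>e. (e choose j) * (T (n - j) + T (n - Suc j)))"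
      using Suc l by (simp add: algebra_simps sum.distrib sum_distrib_left)
    also have "\<dots> = q * (\<Sum>j\<le>Suc e. (Suc e choose j) * T (n - j))"
      by (simp only: sum_binomial_Suc)
    finally show ?case .
  qed
  have "T (Suc n) = q * (\<Sum>j\<le>n. (n choose j) * T (n - j))"
    using row[of n n] diagonal[of n] by simp
  also have "(\<Sum>j\<le>n. (n choose j) * T (n - j)) = (\<Sum>j\<le>n. (n choose (n - j)) * T j)"
    by (subst sum.nat_diff_reindex[symmetric, where n = "Suc n", unfolded lessThan_Suc_atMost])
       (auto intro!: sum.cong)
  also have "\<dots> = (\<Sum>j\<le>n. (n choose j) * T j)"
    by (intro sum.cong) (auto simp: binomial_symmetric[symmetric])
  finally show ?thesis .
qed

section \<open>Appending a letter to a permutation\<close>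

definition left_rank :: "(nat \<Rightarrow> nat) \<Rightarrow> nat \<Rightarrow> nat" where
  "left_rank \<pi> i = card {j. 1 \<le> j \<and> j < i \<and> \<pi> j < \<pi> i}"

definition make_room :: "nat \<Rightarrow> nat \<Rightarrow> nat" where
  "make_room v x = (if x < v then x else Suc x)"

text \<open>The permutation of size \<open>m + 1\<close> with last letter \<open>v\<close> whose other letters are
  order-isomorphic to \<open>\<pi>\<close>.\<close>

definition append_letter :: "nat \<Rightarrow> nat \<Rightarrow> (nat \<Rightarrow> nat) \<Rightarrow> nat \<Rightarrow> nat" where
  "append_letter m v \<pi> i =
     (if i = Suc m then v else if i \<in> {1..m} then make_room v (\<pi> i) else i)"

lemma make_room_less_iff [simp]: "make_room v x < make_room v y \<longleftrightarrow> x < y"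
  by (auto simp: make_room_def)

lemma make_room_eq_iff [simp]: "make_room v x = make_room v y \<longleftrightarrow> x = y"
  by (auto simp: make_room_def)

lemma make_room_neq [simp]: "make_room v x \<noteq> v" "v \<noteq> make_room v x"
  by (auto simp: make_room_def)

lemma less_make_room_iff [simp]: "v < make_room v x \<longleftrightarrow> v \<le> x"
  by (auto simp: make_room_def)

lemma append_letter_last [simp]: "append_letter m v \<pi> (Suc m) = v"
  by (simp add: append_letter_def)

lemma append_letter_init [simp]:
  "1 \<le> i \<Longrightarrow> i \<le> m \<Longrightarrow> append_letter m v \<pi> i = make_room v (\<pi> i)"
  by (simp add: append_letter_def)

lemma append_letter_permutes:
  assumes \<pi>: "\<pi> permutes {1..m}" and v: "v \<in> {1..Suc m}"
  shows "append_letter m v \<pi> permutes {1..Suc m}"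
proof (rule bij_imp_permutes)
  let ?f = "append_letter m v \<pi>"
  have inj: "inj_on ?f {1..Suc m}"
  proof (rule inj_onI)
    fix i j assume "i \<in> {1..Suc m}" "j \<in> {1..Suc m}" "?f i = ?f j"
    then show "i = j"
      using permutes_inj[OF \<pi>]
      by (cases "i = Suc m"; cases "j = Suc m") (auto dest: injD)
  qed
  have "?f ` {1..Suc m} \<subseteq> {1..Suc m}"
  proof (rule image_subsetI)
    fix i assume i: "i \<in> {1..Suc m}"
    show "?f i \<in> {1..Suc m}"
    proof (cases "i = Suc m")
      case False
      then have "\<pi> i \<in> {1..m}" using i permutes_in_image[OF \<pi>, of i] by auto
      then show ?thesis using False i by (auto simp: make_room_def)
    qed (use v in simp)
  qed
  with inj show "bij_betw ?f {1..Suc m} {1..Suc m}"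
    by (simp add: bij_betw_def endo_inj_surj)
  show "?f i = i" if "i \<notin> {1..Suc m}" for i
    using that by (auto simp: append_letter_def)
qed

lemma append_letter_inj:
  assumes "\<pi> permutes {1..m}" "\<rho> permutes {1..m}"
    and eq: "append_letter m v \<pi> = append_letter m w \<rho>"
  shows "v = w \<and> \<pi> = \<rho>"
proof
  show vw: "v = w" using fun_cong[OF eq, of "Suc m"] by simp
  show "\<pi> = \<rho>"
  proof
    fix i show "\<pi> i = \<rho> i"
    proof (cases "i \<in> {1..m}")
      case True
      then show ?thesis using fun_cong[OF eq, of i] vw by simp
    next
      case False
      then show ?thesis using assms(1,2) by (simp add: permutes_not_in)
    qed
  qed
qed

text \<open>Injectivity makes \<open>append_letter\<close> surjective by counting: there are \<open>(m + 1) * m!\<close> pairs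
  consisting of a letter and a permutation.\<close>

lemma append_letter_surj:
  assumes \<pi>: "\<pi> permutes {1..Suc m}"
  obtains \<rho> where "\<rho> permutes {1..m}" "\<pi> = append_letter m (\<pi> (Suc m)) \<rho>"
proof -
  let ?D = "{1..Suc m} \<times> {\<rho>. \<rho> permutes {1..m}}"
  let ?f = "\<lambda>(v, \<rho>). append_letter m v \<rho>"
  have "inj_on ?f ?D"
  proof (rule inj_onI, clarify)
    fix v \<rho> w \<tau>
    assume "\<rho> permutes {1..m}" "\<tau> permutes {1..m}" "append_letter m v \<rho> = append_letter m w \<tau>"
    then show "v = w \<and> \<rho> = \<tau>" by (rule append_letter_inj)
  qed
  then have "card (?f ` ?D) = card ?D"
    by (rule card_image)
  also have "\<dots> = card {\<pi>. \<pi> permutes {1..Suc m}}"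
    by (simp add: card_cartesian_product card_permutations[where n = m]
        card_permutations[where n = "Suc m"])
  finally have card: "card (?f ` ?D) = card {\<pi>. \<pi> permutes {1..Suc m}}" .
  have "?f ` ?D \<subseteq> {\<pi>. \<pi> permutes {1..Suc m}}"
    by (clarify, rule append_letter_permutes)
  then have "?f ` ?D = {\<pi>. \<pi> permutes {1..Suc m}}"
    by (rule card_subset_eq[OF _ _ card, rotated]) (simp add: finite_permutations)
  with \<pi> have "\<pi> \<in> ?f ` ?D" by simp
  then obtain v \<rho> where "\<rho> permutes {1..m}" "\<pi> = append_letter m v \<rho>"
    by auto
  then show thesis using that by simp
qed

lemma left_rank_append_letter:
  assumes "1 \<le> i" "i \<le> m"
  shows "left_rank (append_letter m v \<pi>) i = left_rank \<pi> i"
  unfolding left_rank_def by (rule arg_cong[of _ _ card]) (use assms in auto)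

lemma left_rank_last:
  assumes \<pi>: "\<pi> permutes {1..m}" and m: "m \<ge> 1"
  shows "left_rank \<pi> m = \<pi> m - 1"
proof -
  let ?J = "{j. 1 \<le> j \<and> j < m \<and> \<pi> j < \<pi> m}"
  have "\<pi> ` ?J = {1..<\<pi> m}"
  proof (intro equalityI subsetI)
    fix y assume "y \<in> \<pi> ` ?J"
    then obtain j where j: "j \<in> ?J" "y = \<pi> j" by blast
    then have "\<pi> j \<in> {1..m}" using permutes_in_image[OF \<pi>, of j] by auto
    then show "y \<in> {1..<\<pi> m}" using j by auto
  next
    fix y assume y: "y \<in> {1..<\<pi> m}"
    have "\<pi> m \<in> {1..m}" using permutes_in_image[OF \<pi>, of m] m by auto
    then have "y \<in> \<pi> ` {1..m}" using y permutes_image[OF \<pi>] by auto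
    then obtain j where j: "j \<in> {1..m}" "y = \<pi> j" by blast
    then have "j \<noteq> m" using y by auto
    then show "y \<in> \<pi> ` ?J" using j y by auto
  qed
  moreover have "inj_on \<pi> ?J"
    using permutes_inj[OF \<pi>] by (rule inj_on_subset) simp
  then have "card (\<pi> ` ?J) = card ?J"
    by (rule card_image)
  ultimately show ?thesis
    by (simp add: left_rank_def)
qed

section \<open>Counting tame permutations\<close>

definition tame :: "nat \<Rightarrow> nat \<Rightarrow> (nat \<Rightarrow> nat) set" where
  "tame q m = {\<pi>. \<pi> permutes {1..m} \<and>
     (\<forall>i. q \<le> i \<and> i < m \<and> \<pi> i > \<pi> (Suc i) \<longrightarrow> left_rank \<pi> (Suc i) < q)}"

lemma finite_tame [simp]: "finite (tame q m)"
  unfolding tame_def by (rule finite_subset[OF _ finite_permutations[of "{1..m}"]]) auto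

lemma tame_last_le: "\<pi> \<in> tame q m \<Longrightarrow> \<pi> m \<le> m"
  unfolding tame_def using permutes_in_image[of \<pi> "{1..m}" m]
  by (cases "m = 0") auto

lemma tame_last_pos: "\<pi> \<in> tame q (Suc m) \<Longrightarrow> 0 < \<pi> (Suc m)"
  unfolding tame_def using permutes_in_image[of \<pi> "{1..Suc m}" "Suc m"] by auto

text \<open>Only the descent condition at position \<open>m\<close> is new: there is a descent iff \<open>v \<le> \<pi> m\<close>, and the
  last position has left rank \<open>v - 1\<close>. If \<open>m < q\<close> there is no new condition, and \<open>v \<le> q\<close> holds
  by itself.\<close>

lemma append_letter_tame_iff:
  assumes q: "q \<ge> 1" and \<pi>: "\<pi> permutes {1..m}" and v: "v \<in> {1..Suc m}"
  shows "append_letter m v \<pi> \<in> tame q (Suc m) \<longleftrightarrow> \<pi> \<in> tame q m \<and> (v \<le> q \<or> \<pi> m < v)"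
proof -
  let ?f = "append_letter m v \<pi>"
  let ?ok = "\<lambda>\<pi> i. \<pi> (Suc i) < \<pi> i \<longrightarrow> left_rank \<pi> (Suc i) < q"
  have f: "?f permutes {1..Suc m}" by (rule append_letter_permutes[OF \<pi> v])
  have init: "?ok ?f i \<longleftrightarrow> ?ok \<pi> i" if "q \<le> i" "i < m" for i
    using that q by (simp add: left_rank_append_letter)
  have last: "?ok ?f m \<longleftrightarrow> v \<le> q \<or> \<pi> m < v" if "q \<le> m"
    using that q v left_rank_last[OF f] by auto
  have "?f \<in> tame q (Suc m) \<longleftrightarrow> (\<forall>i. q \<le> i \<and> i < Suc m \<longrightarrow> ?ok ?f i)"
    using f unfolding tame_def by blast
  also have "\<dots> \<longleftrightarrow> (\<forall>i. q \<le> i \<and> i < m \<longrightarrow> ?ok ?f i) \<and> (q \<le> m \<longrightarrow> ?ok ?f m)"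
    by (auto simp: less_Suc_eq)
  also have "\<dots> \<longleftrightarrow> (\<forall>i. q \<le> i \<and> i < m \<longrightarrow> ?ok \<pi> i) \<and> (q \<le> m \<longrightarrow> v \<le> q \<or> \<pi> m < v)"
    using init last by blast
  also have "\<dots> \<longleftrightarrow> \<pi> \<in> tame q m \<and> (v \<le> q \<or> \<pi> m < v)"
    using \<pi> v unfolding tame_def by auto
  finally show ?thesis .
qed

lemma card_tame_last_eq:
  assumes q: "q \<ge> 1" and v: "v \<in> {1..Suc m}"
  shows "card {\<pi> \<in> tame q (Suc m). \<pi> (Suc m) = v} = card {\<pi> \<in> tame q m. v \<le> q \<or> \<pi> m < v}"
    (is "card ?L = card ?R")
proof -
  have "?L = append_letter m v ` ?R"
  proof (intro equalityI subsetI)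
    fix \<pi> assume \<pi>: "\<pi> \<in> ?L"
    then have "\<pi> permutes {1..Suc m}" by (simp add: tame_def)
    then obtain \<rho> where \<rho>: "\<rho> permutes {1..m}" "\<pi> = append_letter m (\<pi> (Suc m)) \<rho>"
      by (rule append_letter_surj)
    then have eq: "\<pi> = append_letter m v \<rho>" using \<pi> by simp
    then have "\<rho> \<in> ?R"
      using append_letter_tame_iff[OF q \<rho>(1) v] \<pi> by auto
    with eq show "\<pi> \<in> append_letter m v ` ?R" by blast
  next
    fix \<pi> assume "\<pi> \<in> append_letter m v ` ?R"
    then obtain \<rho> where \<rho>: "\<rho> \<in> ?R" "\<pi> = append_letter m v \<rho>" by blast
    then have "\<rho> permutes {1..m}" by (simp add: tame_def)
    then show "\<pi> \<in> ?L"
      using append_letter_tame_iff[OF q _ v] \<rho> by auto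
  qed
  moreover have "inj_on (append_letter m v) ?R"
    by (rule inj_onI) (use append_letter_inj tame_def in blast)
  ultimately show ?thesis by (simp add: card_image)
qed

definition tame_last_le_count :: "nat \<Rightarrow> nat \<Rightarrow> nat \<Rightarrow> nat" where
  "tame_last_le_count q m t = card {\<pi> \<in> tame q m. \<pi> m \<le> t}"

lemma tame_last_le_count_diagonal: "tame_last_le_count q m m = card (tame q m)"
  unfolding tame_last_le_count_def
  by (rule arg_cong[of _ _ card]) (auto dest: tame_last_le)

lemma tame_last_le_count_0: "tame_last_le_count q (Suc m) 0 = 0"
proof -
  have "{\<pi> \<in> tame q (Suc m). \<pi> (Suc m) \<le> 0} = {}"
    using tame_last_pos by force
  then show ?thesis unfolding tame_last_le_count_def by simp
qed

lemma tame_last_le_count_Suc: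
  assumes q: "q \<ge> 1" and t: "t \<le> m"
  shows "tame_last_le_count q (Suc m) (Suc t) = tame_last_le_count q (Suc m) t +
           (if t < q then card (tame q m) else tame_last_le_count q m t)"
proof -
  have "{\<pi> \<in> tame q (Suc m). \<pi> (Suc m) \<le> Suc t} =
          {\<pi> \<in> tame q (Suc m). \<pi> (Suc m) \<le> t} \<union> {\<pi> \<in> tame q (Suc m). \<pi> (Suc m) = Suc t}"
    by auto
  then have "tame_last_le_count q (Suc m) (Suc t) = tame_last_le_count q (Suc m) t +
               card {\<pi> \<in> tame q (Suc m). \<pi> (Suc m) = Suc t}"
    unfolding tame_last_le_count_def by (simp only:) (rule card_Un_disjoint; auto)
  moreover have "card {\<pi> \<in> tame q (Suc m). \<pi> (Suc m) = Suc t} =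
                   (if t < q then card (tame q m) else tame_last_le_count q m t)"
    using card_tame_last_eq[OF q, of "Suc t" m] t
    by (auto simp: tame_last_le_count_def less_Suc_eq_le intro!: arg_cong[of _ _ card])
  ultimately show ?thesis by simp
qed

lemma tame_last_le_count_small:
  assumes q: "q \<ge> 1" and "t \<le> q" "t \<le> Suc m"
  shows "tame_last_le_count q (Suc m) t = t * card (tame q m)"
  using assms(2,3)
  by (induction t) (simp_all add: tame_last_le_count_0 tame_last_le_count_Suc[OF q])

lemma card_tame:
  assumes q: "q \<ge> 1"
  shows "card (tame q (n + q - 1)) = fact (q - 1) * q_bell q n"
proof -
  define T where "T = (\<lambda>n. card (tame q (n + q - 1)))"
  \<comment> \<open>Row \<open>n\<close> of the triangle starts at \<open>t = q\<close>, where the growth law changes.\<close>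
  define A where "A = (\<lambda>n e. tame_last_le_count q (n + q - 1) (q + e))"
  obtain p where p: "q = Suc p" using q by (cases q) auto
  have T_Suc: "T (Suc n) = q * (\<Sum>j\<le>n. (n choose j) * T j)" for n
  proof (rule bell_triangle_recurrence[where A = A])
    show "A (Suc n) 0 = q * T n" for n
      using tame_last_le_count_small[OF q, of q "n + p"] by (simp add: A_def T_def p)
    show "A (Suc n) (Suc e) = A (Suc n) e + A n e" if "e < n" for n e
      using tame_last_le_count_Suc[OF q, of "q + e" "n + p"] that by (simp add: A_def p)
    show "A (Suc n) n = T (Suc n)" for n
      using tame_last_le_count_diagonal[of q "n + q"] by (simp add: A_def T_def add.commute)
  qed
  have "tame q (q - 1) = {\<pi>. \<pi> permutes {1..q - 1}}"
    unfolding tame_def by auto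
  then have T_0: "T 0 = fact (q - 1)"
    by (simp add: T_def card_permutations)
  have "T n = fact (q - 1) * q_bell q n"
  proof (induction n rule: less_induct)
    case (less n)
    show ?case
    proof (cases n)
      case 0
      then show ?thesis by (simp add: T_0 q_bell_def)
    next
      case (Suc k)
      have "T n = q * (\<Sum>j\<le>k. (k choose j) * (fact (q - 1) * q_bell q j))"
        unfolding Suc T_Suc using less Suc by simp
      also have "\<dots> = fact (q - 1) * q_bell q n"
        unfolding Suc q_bell_Suc by (simp add: sum_distrib_left mult_ac)
      finally show ?thesis .
    qed
  qed
  then show ?thesis by (simp add: T_def)
qed

section \<open>The two descriptions of tame permutations\<close>

lemma Del_pred_eq_Des_iff:
  assumes q: "q \<ge> 1" and m: "m \<ge> 1"
  shows "(\<lambda>i. i - 1) ` Del q m \<pi> = Des q m \<pi> \<longleftrightarrow>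
           (\<forall>i. q \<le> i \<and> i < m \<and> \<pi> i > \<pi> (Suc i) \<longrightarrow> left_rank \<pi> (Suc i) < q)"
proof -
  have Del: "Del q m \<pi> = {i. Suc q \<le> i \<and> i \<le> m \<and> left_rank \<pi> i < q}"
    using q by (auto simp: Del_def left_rank_def)
  have pred: "(\<lambda>i. i - 1) ` Del q m \<pi> = {i. q \<le> i \<and> i < m \<and> left_rank \<pi> (Suc i) < q}"
  proof (intro equalityI subsetI)
    fix i assume "i \<in> {i. q \<le> i \<and> i < m \<and> left_rank \<pi> (Suc i) < q}"
    then have "Suc i \<in> Del q m \<pi>" by (simp add: Del)
    then show "i \<in> (\<lambda>i. i - 1) ` Del q m \<pi>" by force
  qed (auto simp: Del)
  have Des: "Des q m \<pi> =
      {i. q \<le> i \<and> i < m \<and> (\<pi> i > \<pi> (Suc i) \<or> left_rank \<pi> (Suc i) < q)}"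
    using m by (auto simp: Des_def Del)
  show ?thesis unfolding pred Des by blast
qed

text \<open>The witness ranks the values of \<open>f\<close> among each other.\<close>

lemma standardisation_exists:
  fixes f :: "nat \<Rightarrow> nat"
  assumes f: "inj_on f {1..q}"
  obtains \<sigma> where "\<sigma> permutes {1..q}"
    "\<And>a b. a \<in> {1..q} \<Longrightarrow> b \<in> {1..q} \<Longrightarrow> \<sigma> a < \<sigma> b \<longleftrightarrow> f a < f b"
proof -
  define \<sigma> where "\<sigma> a = (if a \<in> {1..q} then card {u \<in> {1..q}. f u \<le> f a} else a)" for a
  have mono: "\<sigma> a < \<sigma> b" if "a \<in> {1..q}" "b \<in> {1..q}" "f a < f b" for a b
  proof -
    have "{u \<in> {1..q}. f u \<le> f a} \<subset> {u \<in> {1..q}. f u \<le> f b}"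
    proof
      show "{u \<in> {1..q}. f u \<le> f a} \<subseteq> {u \<in> {1..q}. f u \<le> f b}" using that by auto
      have "b \<in> {u \<in> {1..q}. f u \<le> f b} - {u \<in> {1..q}. f u \<le> f a}" using that by simp
      then show "{u \<in> {1..q}. f u \<le> f a} \<noteq> {u \<in> {1..q}. f u \<le> f b}" by blast
    qed
    then have "card {u \<in> {1..q}. f u \<le> f a} < card {u \<in> {1..q}. f u \<le> f b}"
      by (intro psubset_card_mono) auto
    then show ?thesis using that by (simp add: \<sigma>_def)
  qed
  have iff: "\<sigma> a < \<sigma> b \<longleftrightarrow> f a < f b" if "a \<in> {1..q}" "b \<in> {1..q}" for a b
  proof (cases "f a = f b")
    case True
    then show ?thesis using that by (simp add: \<sigma>_def)
  next
    case False
    then show ?thesis using mono[of a b] mono[of b a] that by force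
  qed
  have "inj_on \<sigma> {1..q}"
  proof (rule inj_onI)
    fix a b assume ab: "a \<in> {1..q}" "b \<in> {1..q}" "\<sigma> a = \<sigma> b"
    then have "f a = f b" using iff[of a b] iff[of b a] by simp
    then show "a = b" using f ab by (auto dest: inj_onD)
  qed
  moreover have "\<sigma> ` {1..q} \<subseteq> {1..q}"
  proof (rule image_subsetI)
    fix a assume a: "a \<in> {1..q}"
    have "card {u \<in> {1..q}. f u \<le> f a} \<le> card {1..q}"
      by (rule card_mono) auto
    moreover have "a \<in> {u \<in> {1..q}. f u \<le> f a}" using a by simp
    then have "card {u \<in> {1..q}. f u \<le> f a} > 0"
      by (intro card_gt_0_iff[THEN iffD2]) auto
    ultimately show "\<sigma> a \<in> {1..q}" using a by (simp add: \<sigma>_def)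
  qed
  ultimately have "bij_betw \<sigma> {1..q} {1..q}"
    by (simp add: bij_betw_def endo_inj_surj)
  then have "\<sigma> permutes {1..q}"
    by (rule bij_imp_permutes) (auto simp: \<sigma>_def)
  then show thesis using iff that by blast
qed

text \<open>In \<open>Pat(q)\<close> the first \<open>q\<close> letters come in every relative order, so only the comparisons with
  the last two letters restrict an occurrence.\<close>

lemma contains_Pat_iff:
  assumes \<pi>: "inj \<pi>"
  shows "(\<exists>p\<in>Pat q. contains_pattern m \<pi> p) \<longleftrightarrow>
           (\<exists>x. 1 \<le> x \<and> x < m \<and> \<pi> x > \<pi> (Suc x) \<and> q \<le> left_rank \<pi> (Suc x))"
proof
  assume "\<exists>p\<in>Pat q. contains_pattern m \<pi> p"
  then obtain \<sigma> where \<sigma>: "\<sigma> permutes {1..q}"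
    and c: "contains_pattern m \<pi> (map \<sigma> [1..<q + 1] @ [q + 2, q + 1])" (is "contains_pattern m \<pi> ?p")
    by (auto simp: Pat_def)
  have length_p: "length ?p - 1 = Suc q" by simp
  from c obtain i where mono: "strict_mono_on {1..Suc q} i"
    and range: "\<And>t. t \<in> {1..Suc q} \<Longrightarrow> 1 \<le> i t \<and> i t < m"
    and iso: "order_isomorphic (map (\<lambda>t. \<pi> (i t)) [1..<Suc q + 1] @ [\<pi> (i (Suc q) + 1)]) ?p"
      (is "order_isomorphic ?l ?p")
    unfolding contains_pattern_def Let_def length_p by blast
  have cmp: "?l ! a < ?l ! b \<longleftrightarrow> ?p ! a < ?p ! b" if "a < q + 2" "b < q + 2" for a b
    using iso that by (simp add: order_isomorphic_def)
  have l: "?l ! a = \<pi> (i (Suc a))" if "a < Suc q" for a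
    using that by (simp add: nth_append del: upt_Suc)
  have l_last: "?l ! (q + 1) = \<pi> (Suc (i (Suc q)))"
    by (simp add: nth_append del: upt_Suc)
  have p: "?p ! a = \<sigma> (Suc a)" if "a < q" for a
    using that by (simp add: nth_append del: upt_Suc)
  have p_last: "?p ! q = q + 2" "?p ! (q + 1) = q + 1"
    by (simp_all add: nth_append del: upt_Suc)
  let ?x = "i (Suc q)"
  have desc: "\<pi> (Suc ?x) < \<pi> ?x"
    using cmp[of "q + 1" q] l[of q] l_last p_last by simp
  have "i ` {1..q} \<subseteq> {j. 1 \<le> j \<and> j < Suc ?x \<and> \<pi> j < \<pi> (Suc ?x)}"
  proof (rule image_subsetI)
    fix t assume t: "t \<in> {1..q}"
    then obtain a where a: "t = Suc a" "a < q" by (cases t) auto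
    have "\<sigma> t \<in> {1..q}" using t permutes_in_image[OF \<sigma>] by blast
    then have "\<pi> (i t) < \<pi> (Suc ?x)"
      using cmp[of a "q + 1"] l[of a] l_last p[of a] p_last a by simp
    moreover have "i t < ?x"
      using t by (intro strict_mono_onD[OF mono]) auto
    ultimately show "i t \<in> {j. 1 \<le> j \<and> j < Suc ?x \<and> \<pi> j < \<pi> (Suc ?x)}"
      using range[of t] t by auto
  qed
  then have "card (i ` {1..q}) \<le> left_rank \<pi> (Suc ?x)"
    unfolding left_rank_def by (intro card_mono) auto
  moreover have "inj_on i {1..q}"
    by (rule inj_on_subset[OF strict_mono_on_imp_inj_on[OF mono]]) auto
  then have "card (i ` {1..q}) = q"
    by (simp add: card_image)
  ultimately show "\<exists>x. 1 \<le> x \<and> x < m \<and> \<pi> x > \<pi> (Suc x) \<and> q \<le> left_rank \<pi> (Suc x)"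
    using desc range[of "Suc q"] by (intro exI[of _ ?x]) auto
next
  assume "\<exists>x. 1 \<le> x \<and> x < m \<and> \<pi> x > \<pi> (Suc x) \<and> q \<le> left_rank \<pi> (Suc x)"
  then obtain x where x: "1 \<le> x" "x < m" and desc: "\<pi> x > \<pi> (Suc x)"
    and rank: "q \<le> left_rank \<pi> (Suc x)" by blast
  obtain B where B: "B \<subseteq> {j. 1 \<le> j \<and> j < Suc x \<and> \<pi> j < \<pi> (Suc x)}" "finite B" "card B = q"
    using obtain_subset_with_card_n[OF rank[unfolded left_rank_def]] by metis
  \<comment> \<open>The occurrence: \<open>q\<close> letters below the descent bottom in order of position, then the descent;
     its pattern is determined by standardising those \<open>q\<close> letters.\<close>
  define s where "s = sorted_list_of_set B"
  have s: "length s = q" "set s = B" "sorted_wrt (<) s"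
    using B by (simp_all add: s_def strict_sorted_list_of_set)
  define i where "i t = (if t \<le> q then s ! (t - 1) else x)" for t
  have i_in: "i t \<in> B" if "t \<in> {1..q}" for t
    using that s by (auto simp: i_def)
  have i_small: "1 \<le> i t \<and> i t < x \<and> \<pi> (i t) < \<pi> (Suc x)" if "t \<in> {1..q}" for t
  proof -
    have "1 \<le> i t" "i t < Suc x" "\<pi> (i t) < \<pi> (Suc x)"
      using i_in[OF that] B(1) by auto
    moreover have "i t \<noteq> x" using calculation desc by auto
    ultimately show ?thesis by simp
  qed
  have i_last: "i (Suc q) = x" by (simp add: i_def)
  have mono: "strict_mono_on {1..Suc q} i"
  proof (rule strict_mono_onI)
    fix a b assume ab: "a \<in> {1..Suc q}" "b \<in> {1..Suc q}" "a < b"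
    show "i a < i b"
    proof (cases "b = Suc q")
      case True
      then show ?thesis using i_small[of a] i_last ab by simp
    next
      case False
      then show ?thesis
        using ab s(1) sorted_wrt_nth_less[OF s(3), of "a - 1" "b - 1"] by (simp add: i_def)
    qed
  qed
  have "inj_on (\<lambda>t. \<pi> (i t)) {1..q}"
  proof (rule inj_onI)
    fix a b assume "a \<in> {1..q}" "b \<in> {1..q}" "\<pi> (i a) = \<pi> (i b)"
    then show "a = b"
      using injD[OF \<pi>] inj_onD[OF strict_mono_on_imp_inj_on[OF mono], of a b] by auto
  qed
  then obtain \<sigma> where \<sigma>: "\<sigma> permutes {1..q}"
    and iff: "\<And>a b. a \<in> {1..q} \<Longrightarrow> b \<in> {1..q} \<Longrightarrow> \<sigma> a < \<sigma> b \<longleftrightarrow> \<pi> (i a) < \<pi> (i b)"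
    by (rule standardisation_exists) blast
  let ?p = "map \<sigma> [1..<q + 1] @ [q + 2, q + 1]"
  let ?l = "map (\<lambda>t. \<pi> (i t)) [1..<Suc q + 1] @ [\<pi> (i (Suc q) + 1)]"
  have l: "?l ! a = \<pi> (i (Suc a))" if "a < q" for a
    using that by (simp add: nth_append del: upt_Suc)
  have l_last: "?l ! q = \<pi> x" "?l ! Suc q = \<pi> (Suc x)"
    by (simp_all add: nth_append i_last del: upt_Suc)
  have p: "?p ! a = \<sigma> (Suc a)" if "a < q" for a
    using that by (simp add: nth_append del: upt_Suc)
  have p_last: "?p ! q = q + 2" "?p ! Suc q = q + 1"
    by (simp_all add: nth_append del: upt_Suc)
  have \<sigma>_le: "\<sigma> (Suc a) \<le> q" if "a < q" for a
    using permutes_in_image[OF \<sigma>, of "Suc a"] that by auto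
  have i_less: "\<pi> (i (Suc a)) < \<pi> (Suc x)" if "a < q" for a
    using i_small[of "Suc a"] that by simp
  have "?l ! a < ?l ! b \<longleftrightarrow> ?p ! a < ?p ! b" if ab: "a < q + 2" "b < q + 2" for a b
  proof -
    consider "a < q" "b < q" | "a < q" "b = q \<or> b = Suc q" | "a = q \<or> a = Suc q" "b < q"
      | "a = q \<or> a = Suc q" "b = q \<or> b = Suc q"
      using ab by linarith
    then show ?thesis
    proof cases
      case 1
      then show ?thesis using iff[of "Suc a" "Suc b"] by (simp only: l p) simp
    next
      case 2
      then have "?l ! a < ?l ! b" "?p ! a < ?p ! b"
        using i_less[of a] desc l[of a] l_last \<sigma>_le[of a] p[of a] p_last by auto
      then show ?thesis by blast
    next
      case 3
      then have "\<not> ?l ! a < ?l ! b" "\<not> ?p ! a < ?p ! b"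
        using i_less[of b] desc l[of b] l_last \<sigma>_le[of b] p[of b] p_last by auto
      then show ?thesis by blast
    next
      case 4
      then show ?thesis using desc l_last p_last by auto
    qed
  qed
  then have "order_isomorphic ?l ?p"
    unfolding order_isomorphic_def by (auto simp del: upt_Suc)
  moreover have "\<forall>t\<in>{1..Suc q}. 1 \<le> i t \<and> i t < m"
  proof
    fix t assume "t \<in> {1..Suc q}"
    then show "1 \<le> i t \<and> i t < m"
      using i_small[of t] i_last x by (cases "t = Suc q") auto
  qed
  moreover have "length ?p - 1 = Suc q" by simp
  ultimately have "contains_pattern m \<pi> ?p"
    unfolding contains_pattern_def Let_def using mono by metis
  moreover have "?p \<in> Pat q" using \<sigma> by (auto simp: Pat_def)
  ultimately show "\<exists>p\<in>Pat q. contains_pattern m \<pi> p" by blast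
qed

text \<open>The top of the descent is not below its bottom, which leaves \<open>i - 1\<close> candidates. Pattern
  occurrences therefore only use descents at positions \<open>i > q\<close>, although avoidance does not
  mention \<open>q\<close> as a lower bound for \<open>i\<close>.\<close>

lemma left_rank_descent_less:
  assumes "1 \<le> i" "\<pi> (Suc i) < \<pi> i"
  shows "left_rank \<pi> (Suc i) < i"
proof -
  have "{j. 1 \<le> j \<and> j < Suc i \<and> \<pi> j < \<pi> (Suc i)} \<subseteq> {1..<i}"
    using assms less_Suc_eq by auto
  then have "left_rank \<pi> (Suc i) \<le> card {1..<i}"
    unfolding left_rank_def by (intro card_mono) auto
  then show ?thesis using assms by simp
qed

lemma Avoid_eq_tame:
  assumes q: "q \<ge> 1"
  shows "Avoid q m = tame q m"
proof -
  have "(\<forall>p\<in>Pat q. \<not> contains_pattern m \<pi> p) \<longleftrightarrow>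
        (\<forall>i. q \<le> i \<and> i < m \<and> \<pi> i > \<pi> (Suc i) \<longrightarrow> left_rank \<pi> (Suc i) < q)"
    if "\<pi> permutes {1..m}" for \<pi>
    using contains_Pat_iff[OF permutes_inj[OF that], of q m] left_rank_descent_less[of _ \<pi>] q
    by (meson le_trans less_le_trans not_less less_imp_le)
  then show ?thesis unfolding Avoid_def tame_def by blast
qed

theorem corollary2p8:
  fixes n q :: nat
  assumes "n \<ge> 1" and "q \<ge> 1"
  shows "fact (q - 1) * q_bell q n =
           card {\<pi>. \<pi> permutes {1..n + q - 1} \<and>
                    (\<lambda>i. i - 1) ` Del q (n + q - 1) \<pi> = Des q (n + q - 1) \<pi>}
       \<and> card {\<pi>. \<pi> permutes {1..n + q - 1} \<and>
                    (\<lambda>i. i - 1) ` Del q (n + q - 1) \<pi> = Des q (n + q - 1) \<pi>} =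
           card (Avoid q (n + q - 1))"
proof -
  have "n + q - 1 \<ge> 1" using assms by simp
  then have "{\<pi>. \<pi> permutes {1..n + q - 1} \<and>
                 (\<lambda>i. i - 1) ` Del q (n + q - 1) \<pi> = Des q (n + q - 1) \<pi>} = tame q (n + q - 1)"
    using assms(2) by (simp only: Del_pred_eq_Des_iff tame_def)
  then show ?thesis
    using card_tame[OF assms(2), of n] Avoid_eq_tame[OF assms(2)] by simp
qed

end
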